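(* Let $G$ be a group generated by a finite set $X$ and let $H$ be a $K$-quasiconvex subgroup of $G$ (with respect to $X$). If $G$ has a decidable word problem, then the membership problem for $H$ in $G$ is decidable.
   Context: Let $G$ be a group generated by a finite set $X$, and let $X^*=\{x,x^{-1}\mid x\in X\}$. A word in the alphabet $X^*$ is identified with the element of $G$ it represents. The Cayley graph $Cayley(G)$ of $G$ with respect to $X$ has vertex set $G$ and edge set $G\times X^*$, where the edge $(g,x)$ joins the vertex $g$ to the vertex $gx$. The length of a path is the number of its edges, and a geodesic between two vertices is a shortest path in $Cayley(G)$ connecting them. A subgroup $H$ of $G$ is $K$-quasiconvex in $G$ if any geodesic in $Cayley(G)$ with endpoints in $H$ belongs to the $K$-neighborhood of $H$. $G$ has a decidable word problem if there exists an algorithm which, for any word in the alphabet $X^*$, decides whether or not it represents the trivial element of $G$. The membership problem for $H$ in $G$ is decidable if there exists an algorithm which, for any word $w$ in the alphabet $X^*$, decides whether or not $w$ represents an element of $H$. *)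

theory Defs
  imports Complex_Main "HOL-Algebra.Generated_Groups" "HOL-Library.Nat_Bijection" "Graph_Theory.Arc_Walk"
begin

section \<open>Partial recursive functions\<close>

datatype recf =
    Zero
  | Succ
  | Proj nat
  | Comp recf "recf list"
  | PrimRec recf recf
  | Mu recf

text \<open>
  \<open>computes r xs y\<close>: the program \<open>r\<close> halts on the arguments \<open>xs\<close> with result \<open>y\<close>.  Programs are
  not typed by arity; a program applied to arguments it does not fit has no result.  In \<open>PrimRec\<close>
  and \<open>Mu\<close> the recursion resp. search variable is the first argument.
\<close>

inductive computes :: "recf \<Rightarrow> nat list \<Rightarrow> nat \<Rightarrow> bool" where
  Zero: "computes Zero xs 0"
| Succ: "computes Succ [x] (Suc x)"
| Proj: "i < length xs \<Longrightarrow> computes (Proj i) xs (xs ! i)"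
| Comp: "list_all2 (\<lambda>g y. computes g xs y) gs ys \<Longrightarrow> computes f ys z \<Longrightarrow> computes (Comp f gs) xs z"
| PrimRec_0: "computes f xs y \<Longrightarrow> computes (PrimRec f g) (0 # xs) y"
| PrimRec_Suc: "computes (PrimRec f g) (n # xs) y \<Longrightarrow> computes g (n # y # xs) z \<Longrightarrow>
    computes (PrimRec f g) (Suc n # xs) z"
| Mu: "computes f (n # xs) 0 \<Longrightarrow> (\<forall>m<n. \<exists>k. computes f (m # xs) (Suc k)) \<Longrightarrow> computes (Mu f) xs n"

inductive_cases computes_ZeroE: "computes Zero xs y"
inductive_cases computes_SuccE: "computes Succ xs y"
inductive_cases computes_ProjE: "computes (Proj i) xs y"
inductive_cases computes_CompE: "computes (Comp f gs) xs y"
inductive_cases computes_PrimRec_0E: "computes (PrimRec f g) (0 # xs) y"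
inductive_cases computes_PrimRec_SucE: "computes (PrimRec f g) (Suc n # xs) y"
inductive_cases computes_MuE: "computes (Mu f) xs y"

lemma computes_functional: "computes r xs y \<Longrightarrow> computes r xs z \<Longrightarrow> y = z"
proof (induction arbitrary: z rule: computes.induct)
  case (Zero xs)
  then show ?case by (rule computes_ZeroE) simp
next
  case (Succ x)
  then show ?case by (rule computes_SuccE) simp
next
  case (Proj i xs)
  from Proj(2) show ?case by (rule computes_ProjE) simp
next
  case (Comp xs gs ys f v)
  from Comp.prems obtain ys' where
    ys': "list_all2 (\<lambda>g y. computes g xs y) gs ys'" "computes f ys' z"
    by (rule computes_CompE)
  have "ys = ys'"
    using Comp.IH(1) ys'(1) by (auto simp: list_all2_conv_all_nth intro!: nth_equalityI)
  then show ?case using Comp.IH ys'(2) by blast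
next
  case (PrimRec_0 f xs y g)
  from PrimRec_0.prems show ?case by (rule computes_PrimRec_0E) (rule PrimRec_0.IH)
next
  case (PrimRec_Suc f g n xs y v)
  from PrimRec_Suc.prems show ?case
    by (rule computes_PrimRec_SucE) (use PrimRec_Suc.IH in blast)
next
  case (Mu f n xs)
  from Mu.prems have z: "computes f (z # xs) 0" "\<forall>m<z. \<exists>k. computes f (m # xs) (Suc k)"
    by (rule computes_MuE, blast)+
  have "\<not> n < z" using Mu.IH z(2) by blast
  moreover have "\<not> z < n" using Mu.IH z(1) by blast
  ultimately show ?case by simp
qed


section \<open>Decidable languages\<close>

text \<open>
  An input word over the finite alphabet \<open>A\<close> is presented to a program by numbering the letters and
  encoding the resulting list of numbers by \<^const>\<open>list_encode\<close>.  As \<open>A\<close> is finite, any two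
  numberings differ by a finite permutation, so the choice of the numbering is immaterial.
\<close>

definition decidable_language :: "'a set \<Rightarrow> 'a list set \<Rightarrow> bool" where
  "decidable_language A L \<longleftrightarrow>
    (\<exists>num r. bij_betw num A {..<card A} \<and>
      (\<forall>w \<in> lists A. computes r [list_encode (map num w)] (if w \<in> L then 1 else 0)))"


section \<open>Words, Cayley graphs and quasiconvexity\<close>

definition letters :: "('a, 'b) monoid_scheme \<Rightarrow> 'a set \<Rightarrow> 'a set" where
  "letters G X = X \<union> (\<lambda>x. inv\<^bsub>G\<^esub> x) ` X"

definition word_value :: "('a, 'b) monoid_scheme \<Rightarrow> 'a list \<Rightarrow> 'a" where
  "word_value G w = foldr (\<lambda>x y. x \<otimes>\<^bsub>G\<^esub> y) w \<one>\<^bsub>G\<^esub>"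

definition decidable_word_problem :: "('a, 'b) monoid_scheme \<Rightarrow> 'a set \<Rightarrow> bool" where
  "decidable_word_problem G X \<longleftrightarrow>
    decidable_language (letters G X) {w \<in> lists (letters G X). word_value G w = \<one>\<^bsub>G\<^esub>}"

definition decidable_membership_problem ::
  "('a, 'b) monoid_scheme \<Rightarrow> 'a set \<Rightarrow> 'a set \<Rightarrow> bool" where
  "decidable_membership_problem G X H \<longleftrightarrow>
    decidable_language (letters G X) {w \<in> lists (letters G X). word_value G w \<in> H}"

text \<open>
  Each arc \<open>(g, x)\<close> has the opposite arc \<open>(g x, x\<inverse>)\<close>, so directed walks account for all edge paths.
\<close>

definition cayley_graph :: "('a, 'b) monoid_scheme \<Rightarrow> 'a set \<Rightarrow> ('a, 'a \<times> 'a) pre_digraph" where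
  "cayley_graph G X =
    \<lparr> verts = carrier G,
      arcs = carrier G \<times> letters G X,
      tail = fst,
      head = (\<lambda>(g, x). g \<otimes>\<^bsub>G\<^esub> x) \<rparr>"

definition geodesic :: "('v, 'e) pre_digraph \<Rightarrow> 'v \<Rightarrow> 'e list \<Rightarrow> 'v \<Rightarrow> bool" where
  "geodesic C u p v \<longleftrightarrow>
    pre_digraph.awalk C u p v \<and> (\<forall>q. pre_digraph.awalk C u q v \<longrightarrow> length p \<le> length q)"

text \<open>The vertices at distance at most \<open>K\<close> from \<open>S\<close>.\<close>

definition neighborhood :: "('v, 'e) pre_digraph \<Rightarrow> real \<Rightarrow> 'v set \<Rightarrow> 'v set" where
  "neighborhood C K S = {v. \<exists>s \<in> S. \<exists>p. pre_digraph.awalk C s p v \<and> real (length p) \<le> K}"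

text \<open>
  Containment of a geodesic in the neighborhood is required of its vertices only.
\<close>

definition quasiconvex ::
  "('a, 'b) monoid_scheme \<Rightarrow> 'a set \<Rightarrow> real \<Rightarrow> 'a set \<Rightarrow> bool" where
  "quasiconvex G X K H \<longleftrightarrow>
    (\<forall>u \<in> H. \<forall>v \<in> H. \<forall>p. geodesic (cayley_graph G X) u p v \<longrightarrow>
      set (pre_digraph.awalk_verts (cayley_graph G X) u p) \<subseteq> neighborhood (cayley_graph G X) K H)"

end

theory Submission imports Defs
begin

text \<open>
  Let \<open>k\<close> be the integer part of \<open>K\<close>, or zero if \<open>K\<close> is negative, and let \<open>T\<close> be the finite set
  of words of length at most \<open>2 * k + 1\<close> that represent elements of \<open>H\<close>.  Quasiconvexity makes the
  elements of \<open>H\<close> short products of values of \<open>T\<close>: all vertices of a geodesic from the identity to an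
  element of \<open>H\<close> have a point of \<open>H\<close> within distance \<open>k\<close>, and the quotients of the points chosen for
  consecutive vertices are values of words in \<open>T\<close>.  A geodesic of length \<open>n\<close> thus gives a product of
  \<open>n + 1\<close> such values (\<open>factor_path\<close>).

  Applied to the inverse of the value of a word \<open>w\<close>, this shows that \<open>w\<close> represents an element of \<open>H\<close>
  if and only if \<open>u @ w\<close> represents the identity for some product \<open>u\<close> of \<open>N\<close> words from \<open>T\<close>, where
  \<open>N\<close> is any number above the length of \<open>w\<close> (\<open>quasiconvex_membership_iff\<close>).  There are finitely many
  such \<open>u\<close>, and each is tested by the program for the word problem.  Using the inverse means that
  candidates are put in front of \<open>w\<close>, so that the search treats the code of \<open>w\<close> as a mere number and
  never has to take it apart.

  A list of the words in \<open>T\<close>, of some length \<open>b\<close>, is built into the program.  The candidates \<open>u\<close> are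
  numbered by the \<open>m < b ^ N\<close>, whose digits in base \<open>b\<close> select the factors (\<open>digit_word_image\<close>).  For
  \<open>N\<close> the program takes the successor of the code of \<open>w\<close>, since that code is at least the length of
  \<open>w\<close>.  All that remains is arithmetic with recursive functions and a bounded search over \<open>m\<close>.  Every
  candidate is a word in the alphabet, so each call of the program for the word problem halts.
\<close>

section \<open>Composite programs\<close>

lemma computes_eqI: "computes r xs y \<Longrightarrow> y = z \<Longrightarrow> computes r xs z"
  by simp

lemma computes_Comp1:
  "computes g xs y \<Longrightarrow> computes f [y] z \<Longrightarrow> computes (Comp f [g]) xs z"
  by (rule computes.Comp[where ys = "[y]"]) auto

lemma computes_Comp2:
  "computes g1 xs y1 \<Longrightarrow> computes g2 xs y2 \<Longrightarrow> computes f [y1, y2] z \<Longrightarrow>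
    computes (Comp f [g1, g2]) xs z"
  by (rule computes.Comp[where ys = "[y1, y2]"]) auto

lemma computes_Comp3:
  "computes g1 xs y1 \<Longrightarrow> computes g2 xs y2 \<Longrightarrow> computes g3 xs y3 \<Longrightarrow>
    computes f [y1, y2, y3] z \<Longrightarrow> computes (Comp f [g1, g2, g3]) xs z"
  by (rule computes.Comp[where ys = "[y1, y2, y3]"]) auto

lemma computes_Proj: "i < length xs \<Longrightarrow> xs ! i = y \<Longrightarrow> computes (Proj i) xs y"
  using computes.Proj by blast

lemma computes_PrimRec:
  assumes "computes f xs (h 0)"
    and "\<And>i. i < n \<Longrightarrow> computes g (i # h i # xs) (h (Suc i))"
  shows "computes (PrimRec f g) (n # xs) (h n)"
  using assms(2)
  by (induction n) (auto intro: computes.PrimRec_0 computes.PrimRec_Suc assms(1))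

fun const_prog :: "nat \<Rightarrow> recf" where
  "const_prog 0 = Zero"
| "const_prog (Suc n) = Comp Succ [const_prog n]"

lemma computes_const: "computes (const_prog n) xs n"
  by (induction n) (auto intro: computes.Zero computes.Succ computes_Comp1)

text \<open>
  A finite case distinction: the first argument counts down through the list of programs, and
  primitive recursion serves only to tell zero from a successor.
\<close>

fun branch :: "recf list \<Rightarrow> recf" where
  "branch [] = Zero"
| "branch (p # ps) = PrimRec p (Comp (branch ps) [Proj 0, Proj 2])"

lemma computes_branch:
  assumes "\<And>i. i < length ps \<Longrightarrow> computes (ps ! i) [x] (f i)" and "d < length ps"
  shows "computes (branch ps) [d, x] (f d)"
  using assms
proof (induction ps arbitrary: d f)
  case (Cons p ps)
  have "computes (PrimRec p (Comp (branch ps) [Proj 0, Proj 2])) (d # [x]) (f d)"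
  proof (rule computes_PrimRec)
    show "computes p [x] (f 0)"
      using Cons.prems(1)[of 0] by simp
    fix i assume "i < d"
    then have "computes (branch ps) [i, x] (f (Suc i))"
      using Cons.prems(1)[of "Suc j" for j] Cons.prems(2)
      by (intro Cons.IH[of "\<lambda>i. f (Suc i)"]) auto
    then show "computes (Comp (branch ps) [Proj 0, Proj 2]) [i, f i, x] (f (Suc i))"
      by (intro computes_Comp2[where ?y1.0 = i and ?y2.0 = x] computes_Proj) auto
  qed
  then show ?case by simp
qed simp


section \<open>Arithmetic and word codes\<close>

definition add_prog :: recf where
  "add_prog = PrimRec (Proj 0) (Comp Succ [Proj 1])"

lemma computes_add: "computes add_prog [x, y] (x + y)"
  unfolding add_prog_def
  by (rule computes_PrimRec[where h = "\<lambda>x. x + y"])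
    (auto intro!: computes_Proj computes_Comp1 computes.Succ)

definition mult_prog :: recf where
  "mult_prog = PrimRec Zero (Comp add_prog [Proj 1, Proj 2])"

lemma computes_mult: "computes mult_prog [x, y] (x * y)"
  unfolding mult_prog_def
proof (rule computes_PrimRec[where h = "\<lambda>x. x * y"])
  show "computes Zero [y] (0 * y)"
    using computes.Zero by simp
  show "computes (Comp add_prog [Proj 1, Proj 2]) [i, i * y, y] (Suc i * y)" for i
    by (rule computes_eqI, rule computes_Comp2[OF computes.Proj computes.Proj computes_add]) auto
qed

text \<open>The exponent comes first, as the recursion runs over it.\<close>

definition power_prog :: recf where
  "power_prog = PrimRec (const_prog 1) (Comp mult_prog [Proj 1, Proj 2])"

lemma computes_power: "computes power_prog [n, x] (x ^ n)"
  unfolding power_prog_def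
proof (rule computes_PrimRec[where h = "\<lambda>n. x ^ n"])
  show "computes (const_prog 1) [x] (x ^ 0)"
    using computes_const[of 1] by simp
  show "computes (Comp mult_prog [Proj 1, Proj 2]) [i, x ^ i, x] (x ^ Suc i)" for i
    by (rule computes_eqI, rule computes_Comp2[OF computes.Proj computes.Proj computes_mult]) auto
qed

definition pred_prog :: recf where
  "pred_prog = PrimRec Zero (Proj 0)"

lemma computes_pred: "computes pred_prog [x] (x - 1)"
  unfolding pred_prog_def
  by (rule computes_PrimRec[where h = "\<lambda>x. x - 1"]) (auto intro: computes.Zero computes_Proj)

text \<open>The subtrahend comes first, as the recursion runs over it.\<close>

definition monus_prog :: recf where
  "monus_prog = PrimRec (Proj 0) (Comp pred_prog [Proj 1])"

lemma computes_monus: "computes monus_prog [y, x] (x - y)"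
  unfolding monus_prog_def
proof (rule computes_PrimRec[where h = "\<lambda>y. x - y"])
  show "computes (Proj 0) [x] (x - 0)"
    by (auto intro: computes_Proj)
  show "computes (Comp pred_prog [Proj 1]) [i, x - i, x] (x - Suc i)" for i
    by (rule computes_eqI, rule computes_Comp1[OF computes.Proj computes_pred]) auto
qed

text \<open>The quotient is the least \<open>q\<close> with \<open>x < (q + 1) * y\<close>, that is, with \<open>(x + 1) - (q + 1) * y = 0\<close>.\<close>

definition div_prog :: recf where
  "div_prog = Mu (Comp monus_prog
    [Comp mult_prog [Comp Succ [Proj 0], Proj 2], Comp Succ [Proj 1]])"

lemma computes_div:
  assumes "0 < y"
  shows "computes div_prog [x, y] (x div y)"
proof -
  have body: "computes (Comp monus_prog
      [Comp mult_prog [Comp Succ [Proj 0], Proj 2], Comp Succ [Proj 1]]) [q, x, y]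
      (Suc x - Suc q * y)" for q
    by (rule computes_eqI,
      rule computes_Comp2[OF
        computes_Comp2[OF computes_Comp1[OF computes.Proj computes.Succ] computes.Proj
          computes_mult]
        computes_Comp1[OF computes.Proj computes.Succ] computes_monus]) auto
  have "x < Suc (x div y) * y"
    using assms dividend_less_div_times[of y x] by simp
  then have zero: "Suc x - Suc (x div y) * y = 0"
    by simp
  have "\<exists>k. Suc x - Suc q * y = Suc k" if "q < x div y" for q
  proof -
    have "Suc q * y \<le> x div y * y"
      using that by (intro mult_le_mono1) simp
    also have "\<dots> \<le> x"
      by simp
    finally show ?thesis
      by (intro exI[of _ "x - Suc q * y"]) simp
  qed
  then show ?thesis
    unfolding div_prog_def using body zero by (intro computes.Mu) metis+
qed

definition mod_prog :: recf where
  "mod_prog = Comp monus_prog [Comp mult_prog [div_prog, Proj 1], Proj 0]"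

lemma computes_mod:
  assumes "0 < y"
  shows "computes mod_prog [x, y] (x mod y)"
  unfolding mod_prog_def
  by (rule computes_eqI,
      rule computes_Comp2[OF computes_Comp2[OF computes_div[OF assms] computes.Proj computes_mult]
        computes.Proj computes_monus])
    (auto simp: minus_div_mult_eq_mod)

definition triangle_prog :: recf where
  "triangle_prog = PrimRec Zero (Comp add_prog [Proj 1, Comp Succ [Proj 0]])"

lemma computes_triangle: "computes triangle_prog [n] (triangle n)"
  unfolding triangle_prog_def
proof (rule computes_PrimRec[where h = triangle])
  show "computes Zero [] (triangle 0)"
    using computes.Zero by simp
  show "computes (Comp add_prog [Proj 1, Comp Succ [Proj 0]]) [i, triangle i] (triangle (Suc i))"
    for i
    by (rule computes_eqI,
        rule computes_Comp2[OF computes.Proj computes_Comp1[OF computes.Proj computes.Succ]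
          computes_add])
      auto
qed

definition cons_prog :: "nat \<Rightarrow> recf" where
  "cons_prog x = Comp Succ [Comp add_prog
    [Comp triangle_prog [Comp add_prog [const_prog x, Proj 0]], const_prog x]]"

lemma computes_cons: "computes (cons_prog x) [list_encode xs] (list_encode (x # xs))"
  unfolding cons_prog_def
  by (rule computes_eqI,
      rule computes_Comp1[OF computes_Comp2[OF
        computes_Comp1[OF computes_Comp2[OF computes_const computes.Proj computes_add]
          computes_triangle]
        computes_const computes_add] computes.Succ])
    (auto simp: prod_encode_def)

fun prefix_prog :: "nat list \<Rightarrow> recf" where
  "prefix_prog [] = Proj 0"
| "prefix_prog (x # xs) = Comp (cons_prog x) [prefix_prog xs]"

lemma computes_prefix: "computes (prefix_prog us) [list_encode xs] (list_encode (us @ xs))"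
proof (induction us)
  case Nil
  show ?case by (auto intro: computes_Proj)
next
  case (Cons u us)
  then show ?case
    using computes_Comp1[OF Cons computes_cons[of u "us @ xs"]] by simp
qed

text \<open>
  This crude bound makes it unnecessary to compute the length of a word: its code already bounds the
  number of steps of a search.
\<close>

lemma length_le_list_encode: "length xs \<le> list_encode xs"
proof (induction xs)
  case (Cons x xs)
  also have "list_encode xs \<le> prod_encode (x, list_encode xs)"
    by (rule le_prod_encode_2)
  finally show ?case by simp
qed simp


section \<open>Enumerating the products of words from a finite list\<close>

text \<open>
  The lowest \<open>n\<close> digits of \<open>m\<close> in base \<open>length ss\<close>, the most significant one first, select the
  factors.  Digits are extracted by division with a power, because in a primitive recursion over
  \<open>n\<close> the number \<open>m\<close> is a fixed parameter.
\<close>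

fun digit_word :: "'a list list \<Rightarrow> nat \<Rightarrow> nat \<Rightarrow> 'a list" where
  "digit_word ss 0 m = []"
| "digit_word ss (Suc n) m = ss ! (m div length ss ^ n mod length ss) @ digit_word ss n m"

lemma digit_word_map:
  assumes "ss \<noteq> []"
  shows "digit_word (map (map f) ss) n m = map f (digit_word ss n m)"
  using assms by (induction n) auto

text \<open>
  For \<open>i < n\<close> the summand \<open>d * length ss ^ n\<close> adds a multiple of the base to the quotient from which
  digit \<open>i\<close> is read.  Hence putting a new leading digit in front of \<open>m\<close> keeps the factors selected so
  far, and any sequence of factors can be built up one digit at a time.
\<close>

lemma digit_word_add_high:
  assumes "ss \<noteq> []" and "i \<le> n"
  shows "digit_word ss i (d * length ss ^ n + m) = digit_word ss i m"
  using assms(2)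
proof (induction i)
  case (Suc i)
  let ?b = "length ss"
  obtain j where n: "n = i + Suc j"
    using Suc.prems by (metis add_Suc_right less_iff_Suc_add Suc_le_eq)
  have "d * ?b ^ n + m = m + (d * ?b ^ j * ?b) * ?b ^ i"
    unfolding n by (simp add: power_add)
  then have "(d * ?b ^ n + m) div ?b ^ i = m div ?b ^ i + d * ?b ^ j * ?b"
    using assms(1) by (simp only: div_mult_self1 power_not_zero length_0_conv not_False_eq_True)
  then show ?case
    using Suc by simp
qed simp

lemma digit_word_factors:
  assumes "ss \<noteq> []"
  shows "\<exists>us. digit_word ss n m = concat us \<and> length us = n \<and> set us \<subseteq> set ss"
proof (induction n)
  case (Suc n)
  then obtain us where "digit_word ss n m = concat us" "length us = n" "set us \<subseteq> set ss"
    by blast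
  then show ?case
    using assms by (intro exI[of _ "ss ! (m div length ss ^ n mod length ss) # us"]) auto
qed simp

lemma digit_word_image:
  assumes "ss \<noteq> []"
  shows "digit_word ss n ` {..<length ss ^ n} = {concat us |us. length us = n \<and> set us \<subseteq> set ss}"
    (is "?L = ?R")
proof
  show "?L \<subseteq> ?R"
    using digit_word_factors[OF assms] by blast
next
  have index: "\<exists>m < length ss ^ length us. digit_word ss (length us) m = concat us"
    if "set us \<subseteq> set ss" for us
    using that
  proof (induction us)
    case (Cons u us)
    let ?b = "length ss" and ?n = "length us"
    obtain m where m: "m < ?b ^ ?n" "digit_word ss ?n m = concat us"
      using Cons by auto
    obtain d where d: "d < ?b" "ss ! d = u"
      using Cons.prems by (auto simp: in_set_conv_nth)
    have "d * ?b ^ ?n + m < Suc d * ?b ^ ?n"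
      using m by simp
    also have "\<dots> \<le> ?b * ?b ^ ?n"
      using d by (intro mult_le_mono1) simp
    finally have "d * ?b ^ ?n + m < ?b ^ length (u # us)"
      by simp
    moreover have "(d * ?b ^ ?n + m) div ?b ^ ?n = d"
      using m assms by simp
    ultimately have "d * ?b ^ ?n + m < ?b ^ length (u # us)"
        "digit_word ss (length (u # us)) (d * ?b ^ ?n + m) = concat (u # us)"
      using m d digit_word_add_high[OF assms, of ?n ?n d m] by simp_all
    then show ?case by blast
  qed simp
  show "?R \<subseteq> ?L"
  proof
    fix v assume "v \<in> ?R"
    then obtain us where "v = concat us" "length us = n" "set us \<subseteq> set ss"
      by blast
    then show "v \<in> ?L"
      using index[of us] by (metis imageI lessThan_iff)
  qed
qed

definition digit_word_prog :: "nat list list \<Rightarrow> recf" where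
  "digit_word_prog ss = PrimRec (Proj 1)
    (Comp (branch (map prefix_prog ss))
      [Comp mod_prog
        [Comp div_prog [Proj 2, Comp power_prog [Proj 0, const_prog (length ss)]],
         const_prog (length ss)],
       Proj 1])"

lemma computes_digit_word:
  assumes "ss \<noteq> []"
  shows "computes (digit_word_prog ss) [n, m, list_encode xs] (list_encode (digit_word ss n m @ xs))"
  unfolding digit_word_prog_def
proof (rule computes_PrimRec[where h = "\<lambda>n. list_encode (digit_word ss n m @ xs)"])
  let ?b = "length ss"
  show "computes (Proj 1) [m, list_encode xs] (list_encode (digit_word ss 0 m @ xs))"
    by (auto intro: computes_Proj)
  fix i
  let ?ys = "digit_word ss i m @ xs"
    and ?args = "[i, list_encode (digit_word ss i m @ xs), m, list_encode xs]"
  have "computes (Comp div_prog [Proj 2, Comp power_prog [Proj 0, const_prog ?b]]) ?args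
      (m div ?b ^ i)"
    using assms
    by (intro computes_Comp2[where ?y1.0 = m and ?y2.0 = "?b ^ i"] computes_div
        computes_Comp2[where ?y1.0 = i and ?y2.0 = ?b and f = power_prog]
        computes_power computes_Proj computes_const) auto
  then have digit: "computes (Comp mod_prog
      [Comp div_prog [Proj 2, Comp power_prog [Proj 0, const_prog ?b]], const_prog ?b]) ?args
      (m div ?b ^ i mod ?b)"
    using assms by (intro computes_Comp2[OF _ computes_const computes_mod]) auto
  have "computes (branch (map prefix_prog ss)) [m div ?b ^ i mod ?b, list_encode ?ys]
      (list_encode (ss ! (m div ?b ^ i mod ?b) @ ?ys))"
    using assms
    by (intro computes_branch[where f = "\<lambda>d. list_encode (ss ! d @ ?ys)"])
      (auto intro: computes_prefix)
  then show "computes (Comp (branch (map prefix_prog ss))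
      [Comp mod_prog
        [Comp div_prog [Proj 2, Comp power_prog [Proj 0, const_prog ?b]], const_prog ?b],
       Proj 1]) ?args (list_encode (digit_word ss (Suc i) m @ xs))"
    by (intro computes_Comp2[OF digit computes.Proj]) auto
qed

text \<open>
  The disjunction of the previous outcome and the new test is a primitive recursion that
  distinguishes whether the outcome so far is zero.  Both are evaluated, so the tested program has to
  halt for every candidate.
\<close>

definition search_prog :: "recf \<Rightarrow> recf" where
  "search_prog t = PrimRec Zero
    (Comp (PrimRec (Proj 0) (const_prog 1)) [Proj 1, Comp t [Proj 0, Proj 2]])"

lemma computes_search:
  assumes "\<And>m. computes t [m, x] (if P m then 1 else 0)"
  shows "computes (search_prog t) [k, x] (if \<exists>m<k. P m then 1 else 0)"
  unfolding search_prog_def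
proof (rule computes_PrimRec[where h = "\<lambda>k. if \<exists>m<k. P m then 1 else 0"])
  show "computes Zero [x] (if \<exists>m<0. P m then 1 else 0)"
    using computes.Zero by simp
  fix i
  let ?y = "(if \<exists>m<i. P m then 1 else 0) :: nat"
  let ?v = "(if P i then 1 else 0) :: nat"
  have disj: "computes (PrimRec (Proj 0) (const_prog 1)) [y, v] (if y = 0 then v else 1)" for y v
    by (rule computes_PrimRec[where h = "\<lambda>y. if y = 0 then v else 1"])
      (use computes_const[of 1] in \<open>auto intro: computes_Proj\<close>)
  have "computes (Comp t [Proj 0, Proj 2]) [i, ?y, x] ?v"
    by (rule computes_Comp2[where ?y1.0 = i and ?y2.0 = x])
      (use assms in \<open>auto intro: computes_Proj\<close>)
  then show "computes (Comp (PrimRec (Proj 0) (const_prog 1)) [Proj 1, Comp t [Proj 0, Proj 2]])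
      [i, ?y, x] (if \<exists>m<Suc i. P m then 1 else 0)"
    by (intro computes_eqI[OF computes_Comp2[OF computes.Proj _ disj]])
      (auto simp: less_Suc_eq)
qed


section \<open>Words and paths in the Cayley graph\<close>

context group
begin

lemma letters_subset_carrier: "X \<subseteq> carrier G \<Longrightarrow> letters G X \<subseteq> carrier G"
  by (auto simp: letters_def)

lemma word_value_Nil [simp]: "word_value G [] = \<one>"
  and word_value_Cons [simp]: "word_value G (x # w) = x \<otimes> word_value G w"
  by (simp_all add: word_value_def)

lemma word_value_closed: "w \<in> lists (carrier G) \<Longrightarrow> word_value G w \<in> carrier G"
  by (induction w) auto

lemma word_value_letters_closed:
  "X \<subseteq> carrier G \<Longrightarrow> w \<in> lists (letters G X) \<Longrightarrow> word_value G w \<in> carrier G"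
  by (rule word_value_closed, rule subsetD[OF lists_mono[OF letters_subset_carrier]])

lemma word_value_append:
  "u \<in> lists (carrier G) \<Longrightarrow> w \<in> lists (carrier G) \<Longrightarrow>
    word_value G (u @ w) = word_value G u \<otimes> word_value G w"
  by (induction u) (auto simp: m_assoc word_value_closed simp flip: lists_eq_set)

lemma inverse_word:
  assumes "X \<subseteq> carrier G" and "w \<in> lists (letters G X)"
  shows "\<exists>w' \<in> lists (letters G X). length w' = length w \<and> word_value G w' = inv (word_value G w)"
  using assms(2)
proof (induction w)
  case (Cons x w)
  note sub = lists_mono[OF letters_subset_carrier[OF assms(1)]]
  obtain w' where w': "w' \<in> lists (letters G X)" "length w' = length w"
      "word_value G w' = inv (word_value G w)"
    using Cons by auto
  have x: "inv x \<in> letters G X" "x \<in> carrier G"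
    using Cons.hyps assms(1) by (auto simp: letters_def)
  have "word_value G (w' @ [inv x]) = inv (word_value G (x # w))"
    using w' x sub word_value_letters_closed[OF assms(1) Cons.hyps(2)]
    by (subst word_value_append) (auto simp: inv_mult_group)
  then show ?case
    using w' x by (intro bexI[of _ "w' @ [inv x]"]) auto
qed simp

lemma cayley_awalk_Nil:
  "pre_digraph.awalk (cayley_graph G X) g [] v \<longleftrightarrow> g \<in> carrier G \<and> g = v"
  by (auto simp: pre_digraph.awalk_def pre_digraph.cas.simps cayley_graph_def)

lemma cayley_awalk_Cons:
  assumes "X \<subseteq> carrier G"
  shows "pre_digraph.awalk (cayley_graph G X) g ((g', x) # p) v \<longleftrightarrow>
    g \<in> carrier G \<and> g' = g \<and> x \<in> letters G X \<and> pre_digraph.awalk (cayley_graph G X) (g \<otimes> x) p v"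
  using letters_subset_carrier[OF assms]
  by (auto simp: pre_digraph.awalk_def pre_digraph.cas.simps cayley_graph_def)

lemma cayley_awalk_verts:
  "pre_digraph.awalk_verts (cayley_graph G X) g [] = [g]"
  "pre_digraph.awalk_verts (cayley_graph G X) g ((g', x) # p) =
    g' # pre_digraph.awalk_verts (cayley_graph G X) (g' \<otimes> x) p"
  by (auto simp: pre_digraph.awalk_verts.simps cayley_graph_def)

lemma word_of_awalk:
  assumes "X \<subseteq> carrier G" and "pre_digraph.awalk (cayley_graph G X) g p v"
  shows "map snd p \<in> lists (letters G X) \<and> v = g \<otimes> word_value G (map snd p)"
  using assms(2)
proof (induction p arbitrary: g)
  case (Cons e p)
  obtain g' x where e: "e = (g', x)" by force
  note sub = letters_subset_carrier[OF assms(1)]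
  have *: "g \<in> carrier G" "x \<in> letters G X" "map snd p \<in> lists (letters G X)"
      "v = g \<otimes> x \<otimes> word_value G (map snd p)"
    using Cons by (auto simp: e cayley_awalk_Cons[OF assms(1)])
  have "word_value G (map snd p) \<in> carrier G"
    by (rule word_value_letters_closed[OF assms(1) *(3)])
  moreover have "x \<in> carrier G"
    using *(2) sub by blast
  ultimately show ?case
    using * by (simp add: e m_assoc)
qed (auto simp: cayley_awalk_Nil)

lemma awalk_of_word:
  assumes "X \<subseteq> carrier G" and "w \<in> lists (letters G X)" and "g \<in> carrier G"
  shows "\<exists>p. pre_digraph.awalk (cayley_graph G X) g p (g \<otimes> word_value G w) \<and> length p = length w"
  using assms(2,3)
proof (induction w arbitrary: g)
  case (Cons x w)
  note sub = letters_subset_carrier[OF assms(1)]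
  have x: "x \<in> carrier G" using Cons.hyps sub by blast
  have w: "word_value G w \<in> carrier G"
    by (rule word_value_letters_closed[OF assms(1) Cons.hyps(2)])
  obtain p where "pre_digraph.awalk (cayley_graph G X) (g \<otimes> x) p (g \<otimes> x \<otimes> word_value G w)"
      "length p = length w"
    using Cons x by blast
  then show ?case
    using Cons.prems Cons.hyps x w
    by (intro exI[of _ "(g, x) # p"]) (auto simp: cayley_awalk_Cons[OF assms(1)] m_assoc)
qed (auto simp: cayley_awalk_Nil)

lemma geodesic_le_word:
  assumes "X \<subseteq> carrier G" and "w \<in> lists (letters G X)"
  shows "\<exists>p. geodesic (cayley_graph G X) \<one> p (word_value G w) \<and> length p \<le> length w"
proof -
  let ?A = "\<lambda>p. pre_digraph.awalk (cayley_graph G X) \<one> p (word_value G w)"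
  obtain q where q: "?A q" "length q = length w"
    using awalk_of_word[OF assms one_closed] word_value_letters_closed[OF assms] by auto
  obtain p where "?A p" "\<And>q. ?A q \<Longrightarrow> length p \<le> length q"
    using ex_has_least_nat[of ?A q length] q(1) by blast
  then show ?thesis
    using q unfolding geodesic_def by force
qed


section \<open>Quasiconvex subgroups and short factors\<close>

definition short_words :: "'a set \<Rightarrow> 'a set \<Rightarrow> nat \<Rightarrow> 'a list set" where
  "short_words X H n = {w \<in> lists (letters G X). length w \<le> n \<and> word_value G w \<in> H}"

lemma finite_short_words: "finite X \<Longrightarrow> finite (short_words X H n)"
  by (rule finite_subset[OF _ finite_lists_length_le[of "letters G X" n]])
    (auto simp: short_words_def letters_def)

lemma concat_short_words:
  assumes "X \<subseteq> carrier G" and "subgroup H G" and "set us \<subseteq> short_words X H n"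
  shows "concat us \<in> lists (letters G X) \<and> word_value G (concat us) \<in> H"
  using assms(3)
proof (induction us)
  case (Cons u us)
  note sub = lists_mono[OF letters_subset_carrier[OF assms(1)]]
  have u: "u \<in> lists (letters G X)" "word_value G u \<in> H"
    using Cons.prems by (auto simp: short_words_def)
  have us: "concat us \<in> lists (letters G X)" "word_value G (concat us) \<in> H"
    using Cons by auto
  have "word_value G (u @ concat us) = word_value G u \<otimes> word_value G (concat us)"
    using u us sub by (intro word_value_append) blast+
  then show ?case
    using u us subgroup.m_closed[OF assms(2)] by auto
qed (auto intro: subgroup.one_closed assms)

text \<open>
  Each vertex \<open>g\<close> of the path is joined to some \<open>h\<close> in \<open>H\<close> by a word of length at most \<open>k\<close>.  For
  consecutive vertices, going from \<open>h\<close> to \<open>g\<close>, along the edge, and back to the next point of \<open>H\<close>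
  spells a word of length at most \<open>2 * k + 1\<close> with value in \<open>H\<close>.  One more factor leads from the last
  of the chosen points to the end of the path.
\<close>

lemma factor_path:
  assumes X: "X \<subseteq> carrier G" and H: "subgroup H G"
    and "pre_digraph.awalk (cayley_graph G X) g p v" and "v \<in> H"
    and "\<And>y. y \<in> set (pre_digraph.awalk_verts (cayley_graph G X) g p) \<Longrightarrow>
      \<exists>s \<in> H. \<exists>b \<in> lists (letters G X). length b \<le> k \<and> y = s \<otimes> word_value G b"
    and "h \<in> H" and "a \<in> lists (letters G X)" and "length a \<le> k" and "g = h \<otimes> word_value G a"
  shows "\<exists>us. length us = Suc (length p) \<and> set us \<subseteq> short_words X H (2 * k + 1) \<and>
    h \<otimes> word_value G (concat us) = v"
  using assms(3-)
proof (induction p arbitrary: g h a)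
  case Nil
  have a: "word_value G a \<in> carrier G"
    using Nil.prems by (intro word_value_letters_closed[OF X])
  have h: "h \<in> carrier G"
    using Nil.prems subgroup.mem_carrier[OF H] by blast
  have v: "h \<otimes> word_value G a = v"
    using Nil.prems by (simp add: cayley_awalk_Nil)
  then have "word_value G a = inv h \<otimes> v"
    using a h by (simp add: m_assoc[symmetric] flip: v)
  then have "word_value G a \<in> H"
    using Nil.prems subgroup.m_closed[OF H] subgroup.m_inv_closed[OF H] by simp
  then show ?case
    using Nil.prems v by (intro exI[of _ "[a]"]) (auto simp: short_words_def)
next
  case (Cons e p)
  note sub = lists_mono[OF letters_subset_carrier[OF X]]
  obtain g' x where e: "e = (g', x)" by force
  have g: "g \<in> carrier G" "g' = g" and xL: "x \<in> letters G X"
    and walk: "pre_digraph.awalk (cayley_graph G X) (g \<otimes> x) p v"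
    using Cons.prems(1) by (auto simp: e cayley_awalk_Cons[OF X])
  have "g \<otimes> x \<in> set (pre_digraph.awalk_verts (cayley_graph G X) (g \<otimes> x) p)"
    by (cases p) (use walk in \<open>auto simp: cayley_awalk_verts cayley_awalk_Cons[OF X]\<close>)
  then obtain s b where s: "s \<in> H" and b: "b \<in> lists (letters G X)" "length b \<le> k"
      and gx: "g \<otimes> x = s \<otimes> word_value G b"
    using Cons.prems(3)[of "g \<otimes> x"] by (auto simp: e g cayley_awalk_verts)
  obtain b' where b': "b' \<in> lists (letters G X)" "length b' = length b"
      "word_value G b' = inv (word_value G b)"
    using inverse_word[OF X b(1)] by blast
  obtain us where us: "length us = Suc (length p)" "set us \<subseteq> short_words X H (2 * k + 1)"
      "s \<otimes> word_value G (concat us) = v"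
    using Cons.IH[OF walk Cons.prems(2) _ s b gx] Cons.prems(3)
    by (auto simp: e g cayley_awalk_verts)
  have carr: "h \<in> carrier G" "s \<in> carrier G" "x \<in> carrier G" "word_value G a \<in> carrier G"
      "word_value G b \<in> carrier G"
    using Cons.prems s subgroup.mem_carrier[OF H] xL letters_subset_carrier[OF X] b sub
    by (auto intro!: word_value_closed)
  define u where "u = a @ x # b'"
  have uL: "u \<in> lists (letters G X)" and "length u \<le> 2 * k + 1"
    using Cons.prems b b' xL by (auto simp: u_def)
  have "word_value G u = word_value G a \<otimes> (x \<otimes> inv (word_value G b))"
    unfolding u_def using Cons.prems(5) b' xL sub carr
    by (subst word_value_append) auto
  then have "h \<otimes> word_value G u = (g \<otimes> x) \<otimes> inv (word_value G b)"
    using carr Cons.prems(7) by (simp add: m_assoc)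
  then have hu: "h \<otimes> word_value G u = s"
    using carr by (simp add: gx m_assoc)
  have uc: "word_value G u \<in> carrier G"
    by (rule word_value_letters_closed[OF X uL])
  have "word_value G u = inv h \<otimes> s"
    using uc carr by (simp add: m_assoc[symmetric] flip: hu)
  then have "word_value G u \<in> H"
    using Cons.prems s subgroup.m_closed[OF H] subgroup.m_inv_closed[OF H] by simp
  then have "u \<in> short_words X H (2 * k + 1)"
    using uL \<open>length u \<le> _\<close> by (simp add: short_words_def)
  moreover have "h \<otimes> word_value G (concat (u # us)) = v"
  proof -
    have c: "concat us \<in> lists (letters G X)"
      using concat_short_words[OF X H us(2)] by blast
    have "word_value G (u @ concat us) = word_value G u \<otimes> word_value G (concat us)"
      using uL c sub by (intro word_value_append) blast+
    moreover have "word_value G (concat us) \<in> carrier G"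
      by (rule word_value_letters_closed[OF X c])
    ultimately show ?thesis
      using us(3) carr uc by (simp add: m_assoc[symmetric] hu)
  qed
  ultimately show ?case
    using us by (intro exI[of _ "u # us"]) auto
qed

text \<open>
  Taking the factors from the inverse of the value of \<open>w\<close>, which is in \<open>H\<close> whenever that value is, and
  is no farther from the identity than the length of \<open>w\<close>, places them in front of \<open>w\<close>.
\<close>

lemma quasiconvex_membership_iff:
  assumes X: "X \<subseteq> carrier G" and H: "subgroup H G" and qc: "quasiconvex G X K H"
    and w: "w \<in> lists (letters G X)" and N: "length w < N"
  shows "word_value G w \<in> H \<longleftrightarrow>
    (\<exists>us. length us = N \<and> set us \<subseteq> short_words X H (2 * nat \<lfloor>K\<rfloor> + 1) \<and>
      word_value G (concat us @ w) = \<one>)" (is "_ \<longleftrightarrow> ?R")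
proof -
  note sub = lists_mono[OF letters_subset_carrier[OF X]]
  let ?T = "short_words X H (2 * nat \<lfloor>K\<rfloor> + 1)"
  have wc: "word_value G w \<in> carrier G"
    by (rule word_value_letters_closed[OF X w])
  have split: "word_value G (concat us @ w) = word_value G (concat us) \<otimes> word_value G w"
    and val: "word_value G (concat us) \<in> H" "word_value G (concat us) \<in> carrier G"
    if "set us \<subseteq> ?T" for us
    using concat_short_words[OF X H that] w sub subgroup.mem_carrier[OF H]
    by (auto intro!: word_value_append)
  show ?thesis
  proof
    assume "word_value G w \<in> H"
    then have inv: "inv (word_value G w) \<in> H"
      by (rule subgroup.m_inv_closed[OF H])
    obtain p where geo: "geodesic (cayley_graph G X) \<one> p (inv (word_value G w))"
        and len: "length p \<le> length w"
      using inverse_word[OF X w] geodesic_le_word[OF X] by metis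
    have near: "\<exists>s \<in> H. \<exists>b \<in> lists (letters G X). length b \<le> nat \<lfloor>K\<rfloor> \<and> y = s \<otimes> word_value G b"
      if "y \<in> set (pre_digraph.awalk_verts (cayley_graph G X) \<one> p)" for y
    proof -
      have "y \<in> neighborhood (cayley_graph G X) K H"
        using qc subgroup.one_closed[OF H] inv geo that unfolding quasiconvex_def by blast
      then obtain s q where "s \<in> H" "pre_digraph.awalk (cayley_graph G X) s q y"
          "real (length q) \<le> K"
        unfolding neighborhood_def by blast
      then show ?thesis
        using word_of_awalk[OF X, of s q y]
        by (intro bexI[of _ s] bexI[of _ "map snd q"]) (auto simp: le_nat_floor)
    qed
    obtain us where us: "length us = Suc (length p)" "set us \<subseteq> ?T"
        "\<one> \<otimes> word_value G (concat us) = inv (word_value G w)"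
      using factor_path[OF X H, of \<one> p "inv (word_value G w)" "nat \<lfloor>K\<rfloor>" \<one> "[]"]
        geo inv near subgroup.one_closed[OF H] unfolding geodesic_def by auto
    \<comment> \<open>The empty word is in the list of short words, so it fills up the number of factors.\<close>
    let ?us = "us @ replicate (N - length us) []"
    have "set ?us \<subseteq> ?T"
      using us(2) subgroup.one_closed[OF H] by (auto simp: short_words_def)
    moreover have "concat ?us = concat us"
      by simp
    moreover have "length ?us = N"
      using us(1) len N by simp
    moreover have "word_value G (concat us @ w) = \<one>"
      using us wc val(2)[OF us(2)] split[OF us(2)] by simp
    ultimately show ?R by metis
  next
    assume ?R
    then obtain us where us: "set us \<subseteq> ?T" "word_value G (concat us @ w) = \<one>"
      by blast
    then have "word_value G w = inv (word_value G (concat us))"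
      using split val wc by (metis inv_equality inv_inv)
    then show "word_value G w \<in> H"
      using val us(1) subgroup.m_inv_closed[OF H] by simp
  qed
qed

end


section \<open>Deciding membership\<close>

theorem theorem3:
  fixes G :: "('a, 'b) monoid_scheme" and X H :: "'a set" and K :: real
  assumes "group G"
    and "finite X" and "X \<subseteq> carrier G" and "generate G X = carrier G"
    and "subgroup H G"
    and "quasiconvex G X K H"
    and "decidable_word_problem G X"
  shows "decidable_membership_problem G X H"
proof -
  interpret group G by fact
  let ?A = "letters G X" and ?T = "short_words X H (2 * nat \<lfloor>K\<rfloor> + 1)"
  obtain num r where num: "bij_betw num ?A {..<card ?A}"
    and r: "\<And>w. w \<in> lists ?A \<Longrightarrow>
      computes r [list_encode (map num w)] (if word_value G w = \<one>\<^bsub>G\<^esub> then 1 else 0)"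
    using assms(7) unfolding decidable_word_problem_def decidable_language_def by auto
  obtain ss where ss: "set ss = ?T"
    using finite_list[OF finite_short_words[OF assms(2)]] by blast
  have "[] \<in> ?T"
    using subgroup.one_closed[OF assms(5)] by (simp add: short_words_def)
  then have "ss \<noteq> []"
    using ss by auto
  \<comment> \<open>The test takes the number of a candidate and the code of the word.\<close>
  define t where "t = Comp r [Comp (digit_word_prog (map (map num) ss))
    [Comp Succ [Proj 1], Proj 0, Proj 1]]"
  define d where "d = Comp (search_prog t)
    [Comp power_prog [Comp Succ [Proj 0], const_prog (length ss)], Proj 0]"
  have "computes d [list_encode (map num w)] (if word_value G w \<in> H then 1 else 0)"
    if w: "w \<in> lists ?A" for w
  proof -
    define c where "c = list_encode (map num w)"
    let ?P = "\<lambda>m. word_value G (digit_word ss (Suc c) m @ w) = \<one>\<^bsub>G\<^esub>"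
    have image: "digit_word ss (Suc c) ` {..<length ss ^ Suc c} =
        {concat us |us. length us = Suc c \<and> set us \<subseteq> ?T}"
      using digit_word_image[OF \<open>ss \<noteq> []\<close>] by (simp only: ss)
    have "length w < Suc c"
      using length_le_list_encode[of "map num w"] by (simp add: c_def)
    then have iff: "word_value G w \<in> H \<longleftrightarrow> (\<exists>m < length ss ^ Suc c. ?P m)"
    proof -
      have "word_value G w \<in> H \<longleftrightarrow>
          (\<exists>v \<in> digit_word ss (Suc c) ` {..<length ss ^ Suc c}. word_value G (v @ w) = \<one>\<^bsub>G\<^esub>)"
        unfolding image quasiconvex_membership_iff[OF assms(3,5,6) w \<open>length w < Suc c\<close>] by blast
      then show ?thesis
        by (simp only: bex_simps lessThan_iff Bex_def) blast
    qed
    have "computes t [m, c] (if ?P m then 1 else 0)" for m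
    proof -
      have "digit_word ss (Suc c) m \<in> lists ?A"
        using concat_short_words[OF assms(3,5)] digit_word_factors[OF \<open>ss \<noteq> []\<close>, of "Suc c" m] ss
        by metis
      then have verdict: "computes r [list_encode (map num (digit_word ss (Suc c) m @ w))]
          (if ?P m then 1 else 0)"
        using w by (intro r) (simp only: append_in_lists_conv)
      have candidate: "computes (digit_word_prog (map (map num) ss)) [Suc c, m, c]
          (list_encode (map num (digit_word ss (Suc c) m @ w)))"
      proof -
        have "map (map num) ss \<noteq> []"
          using \<open>ss \<noteq> []\<close> by simp
        from computes_digit_word[OF this, of "Suc c" m "map num w"] show ?thesis
          unfolding digit_word_map[OF \<open>ss \<noteq> []\<close>] map_append c_def[symmetric] .
      qed
      have args: "computes (Comp Succ [Proj 1]) [m, c] (Suc c)"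
          "computes (Proj 0) [m, c] m" "computes (Proj 1) [m, c] c"
        by (auto intro!: computes_Proj computes_Comp1[OF _ computes.Succ])
      show ?thesis
        unfolding t_def by (rule computes_Comp1[OF computes_Comp3[OF args candidate] verdict])
    qed
    then have search: "computes (search_prog t) [length ss ^ Suc c, c]
        (if word_value G w \<in> H then 1 else 0)"
      unfolding iff by (rule computes_search)
    have "computes (Comp Succ [Proj 0]) [c] (Suc c)" and input: "computes (Proj 0) [c] c"
      by (auto intro!: computes_Proj computes_Comp1[OF _ computes.Succ])
    then have "computes (Comp power_prog [Comp Succ [Proj 0], const_prog (length ss)]) [c]
        (length ss ^ Suc c)"
      by (intro computes_Comp2[OF _ computes_const computes_power])
    then show ?thesis
      unfolding d_def c_def[symmetric] by (rule computes_Comp2[OF _ input search])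
  qed
  then show ?thesis
    using num unfolding decidable_membership_problem_def decidable_language_def
    by (intro exI[of _ num] exI[of _ d]) auto
qed

end
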